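(* Let $1\leq p<\infty$, let $X,Y$ be Banach spaces and let $T:X\rightarrow Y$ be an operator. The following are equivalent: (1) $T$ is unconditionally $p$-converging; (2) $T^{*}$ maps bounded subsets of $Y^{*}$ to weakly $p$-limited subsets of $X^{*}$.
   Context: Banach spaces are real or complex; an operator is a continuous linear map; $B_{X^{*}}$ is the closed unit ball of $X^{*}$. For $1\leq p<\infty$, a sequence $(x_n)_n$ in $X$ is weakly $p$-summable, written $(x_n)_n\in l_p^w(X)$, if $\sup\{(\sum_{n=1}^{\infty}|\langle x^*,x_n\rangle|^p)^{1/p}:x^*\in B_{X^*}\}<\infty$; it is unconditionally $p$-summable, written $(x_n)_n\in l_p^u(X)$, if moreover $\sup\{(\sum_{n=m}^{\infty}|\langle x^*,x_n\rangle|^p)^{1/p}:x^*\in B_{X^*}\}\to 0$ as $m\to\infty$. An operator $T:X\to Y$ is unconditionally $p$-converging if $(Tx_n)_n\in l_p^u(Y)$ for every $(x_n)_n\in l_p^w(X)$. A bounded subset $K$ of $X^*$ is weakly $p$-limited if $\lim_{n\to\infty}\sup_{x^*\in K}|\langle x^*,x_n\rangle|=0$ for every $(x_n)_n\in l_p^w(X)$. *)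

theory Defs
  imports "HOL-Analysis.Analysis"
begin

text \<open>
  The scalar field is a type \<open>'k\<close> of class \<^class>\<open>real_normed_field\<close>. By the theorems of
  Gelfand--Mazur and Frobenius such a type is isometrically isomorphic to the real or to the
  complex numbers, so this treats real and complex Banach spaces simultaneously. The class
  \<^class>\<open>banach\<close> only provides multiplication by real scalars; the multiplication by
  elements of \<open>'k\<close> is therefore an explicit parameter that extends it.
\<close>

locale banach_over = vector_space scale
  for scale :: "'k::real_normed_field \<Rightarrow> 'a::banach \<Rightarrow> 'a" +
  assumes scale_of_real: "scale (of_real r) x = r *\<^sub>R x"
    and norm_scale: "norm (scale c x) = norm c * norm x"

lemma banach_over_real: "banach_over (scaleR :: real \<Rightarrow> 'a::banach \<Rightarrow> 'a)"
  by unfold_locales auto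

lemma banach_over_complex: "banach_over ((*) :: complex \<Rightarrow> complex \<Rightarrow> complex)"
  by unfold_locales (auto simp: scaleR_conv_of_real norm_mult algebra_simps)

text \<open>
  The type \<open>'a \<Rightarrow>\<^sub>L 'b\<close> consists of the bounded real-linear maps with the operator norm.
  Operators are its scale-linear elements, and the dual space consists of its scale-linear
  elements with values in the scalar field, with the inherited norm.
\<close>

definition operators ::
    "('k::real_normed_field \<Rightarrow> 'a::banach \<Rightarrow> 'a) \<Rightarrow> ('k \<Rightarrow> 'b::banach \<Rightarrow> 'b) \<Rightarrow> ('a \<Rightarrow>\<^sub>L 'b) set"
  where "operators s t = {T. Vector_Spaces.linear s t (blinfun_apply T)}"

definition dual :: "('k::real_normed_field \<Rightarrow> 'a::banach \<Rightarrow> 'a) \<Rightarrow> ('a \<Rightarrow>\<^sub>L 'k) set"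
  where "dual s = {f. Vector_Spaces.linear s (*) (blinfun_apply f)}"

definition dual_ball :: "('k::real_normed_field \<Rightarrow> 'a::banach \<Rightarrow> 'a) \<Rightarrow> ('a \<Rightarrow>\<^sub>L 'k) set"
  where "dual_ball s = {f \<in> dual s. norm f \<le> 1}"

lemma operators_real: "operators scaleR scaleR = UNIV"
  by (auto simp: operators_def Vector_Spaces.linear_iff blinfun.add_right blinfun.scaleR_right
      real_vector.vector_space_axioms)

lemma dual_real: "dual (scaleR :: real \<Rightarrow> 'a::banach \<Rightarrow> 'a) = UNIV"
  using operators_real[where ?'a = 'a and ?'b = real]
  by (simp add: dual_def operators_def real_scaleR_def[abs_def])

definition adj :: "('a::real_normed_vector \<Rightarrow>\<^sub>L 'b::real_normed_vector) \<Rightarrow>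
    ('b \<Rightarrow>\<^sub>L 'k::real_normed_vector) \<Rightarrow> ('a \<Rightarrow>\<^sub>L 'k)"
  where "adj T g = g o\<^sub>L T"

lemma adj_in_dual:
  assumes "T \<in> operators s t" "g \<in> dual t"
  shows "adj T g \<in> dual s"
  using assms by (auto simp: operators_def dual_def adj_def Vector_Spaces.linear_iff)

text \<open>
  Sequences are indexed from 0. The following is the set of values of
  \<open>(\<Sum>n\<ge>m. |\<langle>f, x n\<rangle>|\<^sup>p)\<^bsup>1/p\<^esup>\<close> for \<open>f\<close> in the dual ball; it is only used
  together with the requirement that all these series converge. The series of a
  nonnegative sequence has a finite sum exactly if the sequence is \<^const>\<open>summable\<close>.
\<close>

definition weak_tail_norms ::
    "('k::real_normed_field \<Rightarrow> 'a::banach \<Rightarrow> 'a) \<Rightarrow> real \<Rightarrow> (nat \<Rightarrow> 'a) \<Rightarrow> nat \<Rightarrow> real set"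
  where "weak_tail_norms s p x m =
    (\<lambda>f. (\<Sum>n. norm (blinfun_apply f (x (n + m))) powr p) powr (1 / p)) ` dual_ball s"

definition weakly_p_summable ::
    "('k::real_normed_field \<Rightarrow> 'a::banach \<Rightarrow> 'a) \<Rightarrow> real \<Rightarrow> (nat \<Rightarrow> 'a) \<Rightarrow> bool"
  where "weakly_p_summable s p x \<longleftrightarrow>
    (\<forall>f\<in>dual_ball s. summable (\<lambda>n. norm (blinfun_apply f (x n)) powr p)) \<and>
    bdd_above (weak_tail_norms s p x 0)"

definition uncond_p_summable ::
    "('k::real_normed_field \<Rightarrow> 'a::banach \<Rightarrow> 'a) \<Rightarrow> real \<Rightarrow> (nat \<Rightarrow> 'a) \<Rightarrow> bool"
  where "uncond_p_summable s p x \<longleftrightarrow>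
    weakly_p_summable s p x \<and> (\<lambda>m. Sup (weak_tail_norms s p x m)) \<longlonglongrightarrow> 0"

definition uncond_p_converging ::
    "('k::real_normed_field \<Rightarrow> 'a::banach \<Rightarrow> 'a) \<Rightarrow> ('k \<Rightarrow> 'b::banach \<Rightarrow> 'b) \<Rightarrow> real \<Rightarrow>
      ('a \<Rightarrow>\<^sub>L 'b) \<Rightarrow> bool"
  where "uncond_p_converging s t p T \<longleftrightarrow>
    (\<forall>x. weakly_p_summable s p x \<longrightarrow> uncond_p_summable t p (\<lambda>n. blinfun_apply T (x n)))"

text \<open>
  The supremum is taken in \<^typ>\<open>ennreal\<close>, so that it is 0 for \<open>K = {}\<close> (the supremum of the
  empty set of reals is unspecified); for bounded \<open>K\<close> it is finite.
\<close>

definition weakly_p_limited ::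
    "('k::real_normed_field \<Rightarrow> 'a::banach \<Rightarrow> 'a) \<Rightarrow> real \<Rightarrow> ('a \<Rightarrow>\<^sub>L 'k) set \<Rightarrow> bool"
  where "weakly_p_limited s p K \<longleftrightarrow>
    K \<subseteq> dual s \<and> bounded K \<and>
    (\<forall>x. weakly_p_summable s p x \<longrightarrow>
      (\<lambda>n. SUP f\<in>K. ennreal (norm (blinfun_apply f (x n)))) \<longlonglongrightarrow> 0)"

end

theory Submission
  imports Defs
begin

text \<open>
  Since \<open>\<langle>T\<^sup>* g, x\<rangle> = \<langle>g, T x\<rangle>\<close>, condition (2), tested on the dual unit ball, says that
  \<open>\<langle>g, T x\<^sub>n\<rangle>\<close> tends to 0 uniformly in \<open>g\<close> for every weakly \<open>p\<close>-summable \<open>x\<close>, whereas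
  condition (1) asks for uniform smallness of the whole tails
  \<open>\<Sum>n\<ge>m. |\<langle>g, T x\<^sub>n\<rangle>|\<^sup>p\<close>. A single term of a tail is at most the tail, so (1) gives (2) after
  rescaling a bounded set of functionals into the unit ball
  (\<open>adj_image_weakly_p_limited\<close>).

  The converse (\<open>uncond_p_converging_if_adj_dual_ball_limited\<close>) uses that (2) holds for all
  weakly \<open>p\<close>-summable sequences, and not only for the given one. If the tails are not uniformly
  small, there are consecutive finite blocks of indices and functionals \<open>g\<^sub>k\<close> in the unit ball with
  \<open>\<Sum> |\<langle>g\<^sub>k, T x\<^sub>n\<rangle>|\<^sup>p > e\<close> over the \<open>k\<close>-th block. On each block, the duality between \<open>l\<^sub>p\<close> and
  \<open>l\<^sub>q\<close> yields coefficients of \<open>l\<^sub>q\<close>-norm at most 1 for which the combination \<open>z\<^sub>k\<close> of the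
  \<open>x\<^sub>n\<close> satisfies \<open>|\<langle>g\<^sub>k, T z\<^sub>k\<rangle>| > e\<^bsup>1/p\<^esup>\<close> (\<open>norming_coefficients\<close>). The same bound on the
  coefficients gives \<open>|\<langle>f, z\<^sub>k\<rangle>|\<^sup>p \<le> \<Sum> |\<langle>f, x\<^sub>n\<rangle>|\<^sup>p\<close> over the block for every functional \<open>f\<close>,
  and the blocks are disjoint, so \<open>z\<close> is again weakly \<open>p\<close>-summable
  (\<open>weakly_p_summable_blocks\<close>). Thus \<open>z\<close> violates (2).
\<close>

section \<open>Dual functionals\<close>

lemma scaleR_in_dual:
  assumes "f \<in> dual s"
  shows "r *\<^sub>R f \<in> dual s"
  using assms by (auto simp: dual_def Vector_Spaces.linear_iff blinfun.scaleR_left scaleR_right_distrib)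

lemma zero_in_dual_ball:
  assumes "banach_over s"
  shows "0 \<in> dual_ball s"
  using assms
  by (auto simp: dual_ball_def dual_def Vector_Spaces.linear_iff banach_over_def
      vector_space_over_itself.vector_space_axioms)

lemma normalized_in_dual_ball:
  assumes "f \<in> dual s" "norm f \<le> C" "0 < C"
  shows "(1 / C) *\<^sub>R f \<in> dual_ball s"
  using assms scaleR_in_dual[of f s "1 / C"] by (simp add: dual_ball_def divide_simps)

lemma dual_ball_in_dual: "f \<in> dual_ball s \<Longrightarrow> f \<in> dual s"
  by (simp add: dual_ball_def)

lemma dual_apply_sum:
  assumes "f \<in> dual s"
  shows "blinfun_apply f (\<Sum>i\<in>I. s (c i) (x i)) = (\<Sum>i\<in>I. c i * blinfun_apply f (x i))"
  using assms by (simp add: blinfun.sum_right dual_def Vector_Spaces.linear_iff)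

section \<open>Summability through finite sums\<close>

text \<open>
  All terms are nonnegative, so one bound on the finite partial sums yields both the convergence of
  the series and the bound on their sums. Finite sums are what the block argument manipulates.
\<close>

lemma weakly_p_summable_iff_finite_sums:
  assumes "0 < p"
  shows "weakly_p_summable s p x \<longleftrightarrow>
    (\<exists>B. \<forall>f\<in>dual_ball s. \<forall>N. (\<Sum>n<N. norm (blinfun_apply f (x n)) powr p) \<le> B)"
proof
  assume w: "weakly_p_summable s p x"
  then obtain b where b: "\<And>v. v \<in> weak_tail_norms s p x 0 \<Longrightarrow> v \<le> b"
    by (auto simp: weakly_p_summable_def bdd_above_def)
  show "\<exists>B. \<forall>f\<in>dual_ball s. \<forall>N. (\<Sum>n<N. norm (blinfun_apply f (x n)) powr p) \<le> B"
  proof (intro exI ballI allI)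
    fix f N assume f: "f \<in> dual_ball s"
    let ?t = "\<lambda>n. norm (blinfun_apply f (x n)) powr p"
    have sm: "summable ?t" using w f by (auto simp: weakly_p_summable_def)
    have "(\<Sum>n<N. ?t n) \<le> (\<Sum>n. ?t n)" by (rule sum_le_suminf[OF sm]) auto
    also have "\<dots> = ((\<Sum>n. ?t n) powr (1 / p)) powr p"
      using assms by (simp add: powr_powr suminf_nonneg[OF sm])
    also have "\<dots> \<le> b powr p"
      using b[of "(\<Sum>n. ?t n) powr (1 / p)"] f assms
      by (intro powr_mono2) (auto simp: weak_tail_norms_def)
    finally show "(\<Sum>n<N. ?t n) \<le> b powr p" .
  qed
next
  assume "\<exists>B. \<forall>f\<in>dual_ball s. \<forall>N. (\<Sum>n<N. norm (blinfun_apply f (x n)) powr p) \<le> B"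
  then obtain B where
    B: "\<And>f N. f \<in> dual_ball s \<Longrightarrow> (\<Sum>n<N. norm (blinfun_apply f (x n)) powr p) \<le> B" by blast
  have sm: "summable (\<lambda>n. norm (blinfun_apply f (x n)) powr p)" if "f \<in> dual_ball s" for f
    using B[OF that] by (intro summableI_nonneg_bounded) auto
  have "v \<le> B powr (1 / p)" if "v \<in> weak_tail_norms s p x 0" for v
    using that assms B by (auto simp: weak_tail_norms_def intro!: powr_mono2 suminf_le_const suminf_nonneg sm)
  then show "weakly_p_summable s p x"
    using sm by (auto simp: weakly_p_summable_def bdd_above_def)
qed

text \<open>
  For a fixed functional the tails decrease in the starting index, so that one good index \<open>M\<close>
  serves all later ones; this is why the limit of the suprema turns into the existence of one \<open>M\<close>.
\<close>

lemma uncond_p_summable_iff_finite_sums: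
  fixes s :: "'k::real_normed_field \<Rightarrow> 'a::banach \<Rightarrow> 'a"
  assumes "0 < p" "banach_over s"
  shows "uncond_p_summable s p x \<longleftrightarrow> weakly_p_summable s p x \<and>
    (\<forall>e>0. \<exists>M. \<forall>f\<in>dual_ball s. \<forall>N.
      (\<Sum>n=M..<N. norm (blinfun_apply f (x n)) powr p) \<le> e)"
    (is "_ \<longleftrightarrow> _ \<and> ?tails")
proof (cases "weakly_p_summable s p x")
  case w: True
  define t where "t f n = norm (blinfun_apply f (x n)) powr p" for f :: "'a \<Rightarrow>\<^sub>L 'k" and n
  let ?W = "weak_tail_norms s p x"
  have t0: "0 \<le> t f n" for f n by (simp add: t_def)
  have sm: "summable (t f)" if "f \<in> dual_ball s" for f
    using w that by (auto simp: weakly_p_summable_def t_def[abs_def])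
  have smk: "summable (\<lambda>n. t f (n + m))" if "f \<in> dual_ball s" for f m
    using sm[OF that] by (simp add: summable_iff_shift)
  have W: "?W m = (\<lambda>f. (\<Sum>n. t f (n + m)) powr (1 / p)) ` dual_ball s" for m
    by (simp add: weak_tail_norms_def t_def)
  have antimono: "(\<Sum>n. t f (n + m)) \<le> (\<Sum>n. t f (n + M))"
    if "f \<in> dual_ball s" "M \<le> m" for f m M
    using suminf_split_initial_segment[OF smk[OF that(1), of M], of "m - M"] that(2)
    by (simp add: sum_nonneg t0 add.assoc)
  have tail_le: "(\<Sum>n=M..<N. t f n) \<le> (\<Sum>n. t f (n + M))" if "f \<in> dual_ball s" for f M N
  proof -
    have "(\<Sum>n=M..<N. t f n) = (\<Sum>n<N - M. t f (n + M))"
      by (rule sum.reindex_bij_witness[of _ "\<lambda>n. n + M" "\<lambda>n. n - M"]) auto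
    also have "\<dots> \<le> (\<Sum>n. t f (n + M))"
      by (rule sum_le_suminf[OF smk[OF that]]) (auto simp: t0)
    finally show ?thesis .
  qed
  have bdd: "bdd_above (?W m)" for m
  proof -
    obtain b where b: "\<And>v. v \<in> ?W 0 \<Longrightarrow> v \<le> b"
      using w by (auto simp: weakly_p_summable_def bdd_above_def)
    have "v \<le> b" if v: "v \<in> ?W m" for v
    proof -
      obtain f where f: "f \<in> dual_ball s" "v = (\<Sum>n. t f (n + m)) powr (1 / p)"
        using v by (auto simp: W)
      have "v \<le> (\<Sum>n. t f (n + 0)) powr (1 / p)"
        unfolding f(2) using assms
        by (intro powr_mono2 antimono f suminf_nonneg smk) (auto simp: t0)
      also have "\<dots> \<le> b" using f by (intro b) (auto simp: W)
      finally show ?thesis .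
    qed
    then show ?thesis by (auto simp: bdd_above_def)
  qed
  have nonneg: "0 \<le> Sup (?W m)" for m
    using zero_in_dual_ball[OF assms(2)] by (intro cSup_upper2[OF _ _ bdd]) (auto simp: W)
  have "(\<lambda>m. Sup (?W m)) \<longlonglongrightarrow> 0 \<longleftrightarrow> ?tails"
  proof
    assume lim: "(\<lambda>m. Sup (?W m)) \<longlonglongrightarrow> 0"
    show ?tails
    proof (intro allI impI)
      fix e :: real assume e: "0 < e"
      have "eventually (\<lambda>m. Sup (?W m) < e powr (1 / p)) sequentially"
        by (rule order_tendstoD[OF lim]) (use e in auto)
      then obtain M where M: "Sup (?W M) < e powr (1 / p)"
        by (auto simp: eventually_sequentially)
      have "(\<Sum>n=M..<N. t f n) \<le> e" if f: "f \<in> dual_ball s" for f N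
      proof -
        have "(\<Sum>n. t f (n + M)) powr (1 / p) \<le> Sup (?W M)"
          by (rule cSup_upper[OF _ bdd]) (use f in \<open>auto simp: W\<close>)
        with M have "(\<Sum>n. t f (n + M)) powr (1 / p) \<le> e powr (1 / p)" by simp
        then have "(\<Sum>n. t f (n + M)) \<le> e"
          using assms e by (meson divide_pos_pos linorder_not_le powr_less_mono2 less_imp_le zero_less_one)
        with tail_le[OF f, where M=M and N=N] show ?thesis by simp
      qed
      then show "\<exists>M. \<forall>f\<in>dual_ball s. \<forall>N.
          (\<Sum>n=M..<N. norm (blinfun_apply f (x n)) powr p) \<le> e"
        by (auto simp: t_def)
    qed
  next
    assume tails: ?tails
    show "(\<lambda>m. Sup (?W m)) \<longlonglongrightarrow> 0"
    proof (rule LIMSEQ_I)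
      fix r :: real assume r: "0 < r"
      have "0 < (r / 2) powr p" using r by simp
      then obtain M where
        M: "\<And>f N. f \<in> dual_ball s \<Longrightarrow> (\<Sum>n=M..<N. t f n) \<le> (r / 2) powr p"
        using tails unfolding t_def by meson
      have "Sup (?W m) \<le> r / 2" if m: "M \<le> m" for m
      proof (rule cSup_least)
        show "?W m \<noteq> {}" using zero_in_dual_ball[OF assms(2)] by (auto simp: W)
        fix v assume "v \<in> ?W m"
        then obtain f where f: "f \<in> dual_ball s" "v = (\<Sum>n. t f (n + m)) powr (1 / p)"
          by (auto simp: W)
        have "(\<Sum>n<k. t f (n + M)) \<le> (r / 2) powr p" for k
        proof -
          have "(\<Sum>n<k. t f (n + M)) = (\<Sum>n=M..<M + k. t f n)"
            by (rule sum.reindex_bij_witness[of _ "\<lambda>n. n - M" "\<lambda>n. n + M"]) auto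
          then show ?thesis using M[OF f(1)] by simp
        qed
        then have "(\<Sum>n. t f (n + M)) \<le> (r / 2) powr p"
          by (intro suminf_le_const smk f)
        with antimono[OF f(1) m] have "(\<Sum>n. t f (n + m)) \<le> (r / 2) powr p" by simp
        then have "v \<le> ((r / 2) powr p) powr (1 / p)"
          unfolding f(2) using assms
          by (intro powr_mono2 suminf_nonneg smk f) (auto simp: t0)
        also have "\<dots> = r / 2" using assms r by (simp add: powr_powr)
        finally show "v \<le> r / 2" .
      qed
      then show "\<exists>M. \<forall>m\<ge>M. norm (Sup (?W m) - 0) < r"
        using nonneg r by (intro exI[of _ M]) (fastforce simp: abs_of_nonneg)
    qed
  qed
  then show ?thesis using w by (simp add: uncond_p_summable_def)
qed (simp add: uncond_p_summable_def)

text \<open>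
  The functional \<open>g \<circ> T\<close> lies in the dual ball after division by a positive bound of \<open>norm T\<close>,
  and the \<open>p\<close>-th powers then scale by a constant.
\<close>

lemma weakly_p_summable_image:
  assumes "0 < p" "T \<in> operators s t" "weakly_p_summable s p x"
  shows "weakly_p_summable t p (\<lambda>n. blinfun_apply T (x n))"
proof -
  \<comment> \<open>The summand 1 keeps the divisor positive when \<open>T = 0\<close>.\<close>
  define C where "C = norm T + 1"
  have C: "0 < C" by (simp add: C_def add_nonneg_pos)
  obtain B where
    B: "\<And>f N. f \<in> dual_ball s \<Longrightarrow> (\<Sum>n<N. norm (blinfun_apply f (x n)) powr p) \<le> B"
    using assms weakly_p_summable_iff_finite_sums by blast
  have "(\<Sum>n<N. norm (blinfun_apply g (blinfun_apply T (x n))) powr p) \<le> C powr p * B"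
    if g: "g \<in> dual_ball t" for g N
  proof -
    have "norm (adj T g) \<le> norm g * norm T" by (simp add: adj_def norm_blinfun_compose)
    also have "\<dots> \<le> 1 * norm T" using g by (intro mult_right_mono) (auto simp: dual_ball_def)
    finally have "norm (adj T g) \<le> C" by (simp add: C_def)
    then have f: "(1 / C) *\<^sub>R adj T g \<in> dual_ball s"
      using adj_in_dual[OF assms(2) dual_ball_in_dual[OF g]] C by (intro normalized_in_dual_ball)
    have "norm (blinfun_apply g (blinfun_apply T (x n))) powr p
        = C powr p * norm (blinfun_apply ((1 / C) *\<^sub>R adj T g) (x n)) powr p" for n
      using C by (simp add: adj_def blinfun.scaleR_left powr_mult[symmetric])
    then show ?thesis
      using B[OF f, of N] by (simp add: sum_distrib_left[symmetric] mult_left_mono)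
  qed
  then show ?thesis
    unfolding weakly_p_summable_iff_finite_sums[OF assms(1)] by blast
qed

section \<open>Norming coefficients\<close>

text \<open>
  Convexity on the open half-line extends to the end point 0, where it amounts to
  \<open>(r w)\<^sup>p \<le> r w\<^sup>p\<close> for \<open>0 < r < 1\<close>, that is, \<open>r\<^sup>p \<le> r\<close>.
\<close>

lemma convex_on_powr_nonneg:
  assumes "1 \<le> p"
  shows "convex_on {0..} (\<lambda>u::real. u powr p)"
proof (rule convex_onI)
  fix t u v :: real
  assume t: "0 < t" "t < 1" and uv: "u \<in> {0..}" "v \<in> {0..}"
  have zero: "(r * w) powr p \<le> r * w powr p" if "0 < r" "r < 1" "0 \<le> w" for r w :: real
  proof -
    have "r powr p \<le> r" using powr_mono'[OF assms, of r] that by simp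
    then show ?thesis using that by (simp add: powr_mult mult_right_mono)
  qed
  show "((1 - t) *\<^sub>R u + t *\<^sub>R v) powr p \<le> (1 - t) * u powr p + t * v powr p"
  proof (cases "u = 0 \<or> v = 0")
    case True
    then show ?thesis using zero[of t v] zero[of "1 - t" u] t uv by auto
  next
    case False
    then show ?thesis
      using convex_onD[OF powr_convex[OF assms], of t u v] t uv by auto
  qed
qed auto

text \<open>
  This is the equality case of Hoelder's inequality for finite sums, over any normed field: the
  coefficients norm the vector \<open>a\<close> of \<open>l\<^sub>p\<close> and, as a functional on \<open>l\<^sub>p\<close>, have norm at
  most 1. Taking \<open>c\<^sub>i\<close> proportional to \<open>|a\<^sub>i|\<^sup>p / a\<^sub>i\<close> makes every \<open>c\<^sub>i a\<^sub>i\<close> a nonnegative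
  real. The norm bound comes from Jensen's inequality for \<open>u\<^sup>p\<close> with weights
  \<open>|a\<^sub>i|\<^sup>p / S\<close> at the points \<open>|b\<^sub>i| / |a\<^sub>i|\<close>, where \<open>S\<close> is the sum of the \<open>|a\<^sub>i|\<^sup>p\<close>.
  Arguing with Jensen instead of the conjugate exponent \<open>q\<close> covers \<open>p = 1\<close>, where
  \<open>q\<close> is infinite, in the same way.
\<close>

lemma norming_coefficients:
  fixes a :: "'i \<Rightarrow> 'k::real_normed_field"
  assumes "1 \<le> p" "finite I" "0 < (\<Sum>i\<in>I. norm (a i) powr p)"
  obtains c where
    "norm (\<Sum>i\<in>I. c i * a i) = (\<Sum>i\<in>I. norm (a i) powr p) powr (1 / p)"
    "\<And>b :: 'i \<Rightarrow> 'k. norm (\<Sum>i\<in>I. c i * b i) powr p \<le> (\<Sum>i\<in>I. norm (b i) powr p)"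
proof -
  define S where "S = (\<Sum>i\<in>I. norm (a i) powr p)"
  define r where "r = S powr (1 / p - 1)"
  \<comment> \<open>If \<open>a i = 0\<close>, division by zero gives \<open>c i = 0\<close>.\<close>
  define c where "c i = of_real (r * norm (a i) powr p) / a i" for i
  have S: "0 < S" using assms(3) by (simp add: S_def)
  have "(\<Sum>i\<in>I. c i * a i) = (\<Sum>i\<in>I. of_real (r * norm (a i) powr p))"
    by (intro sum.cong) (auto simp: c_def)
  also have "\<dots> = of_real (r * S)"
    by (simp add: S_def sum_distrib_left)
  also have "r * S = S powr (1 / p)" using S by (simp add: r_def powr_diff)
  finally have 1: "norm (\<Sum>i\<in>I. c i * a i) = S powr (1 / p)" by simp
  have 2: "norm (\<Sum>i\<in>I. c i * b i) powr p \<le> (\<Sum>i\<in>I. norm (b i) powr p)" for b :: "'i \<Rightarrow> 'k"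
  proof -
    \<comment> \<open>Only these indices have \<open>c i \<noteq> 0\<close>, and only for them \<open>|b\<^sub>i| / |a\<^sub>i|\<close> is meaningful.\<close>
    define J where "J = {i \<in> I. a i \<noteq> 0}"
    have J: "finite J" "J \<subseteq> I" "\<And>i. i \<in> J \<Longrightarrow> a i \<noteq> 0" using assms(2) by (auto simp: J_def)
    have SJ: "S = (\<Sum>i\<in>J. norm (a i) powr p)"
      unfolding S_def J_def using assms(2) by (intro sum.mono_neutral_right) auto
    define w where "w i = norm (a i) powr p / S" for i
    define d where "d i = norm (b i) / norm (a i)" for i
    have w1: "(\<Sum>i\<in>J. w i) = 1" using S SJ by (simp add: w_def sum_divide_distrib[symmetric])
    have "J \<noteq> {}" using w1 by auto
    have "(\<Sum>i\<in>I. c i * b i) = (\<Sum>i\<in>J. c i * b i)"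
      unfolding J_def using assms(2) by (intro sum.mono_neutral_right) (auto simp: c_def)
    then have "norm (\<Sum>i\<in>I. c i * b i) \<le> (\<Sum>i\<in>J. norm (c i * b i))"
      by (simp add: norm_sum)
    also have "\<dots> = (\<Sum>i\<in>J. r * S * (w i * d i))"
      using S by (intro sum.cong) (auto simp: c_def w_def d_def r_def norm_mult norm_divide abs_mult)
    also have "\<dots> = S powr (1 / p) * (\<Sum>i\<in>J. w i * d i)"
      by (simp add: sum_distrib_left[symmetric] \<open>r * S = S powr (1 / p)\<close>)
    finally have "norm (\<Sum>i\<in>I. c i * b i) powr p
        \<le> (S powr (1 / p) * (\<Sum>i\<in>J. w i * d i)) powr p"
      using assms(1) by (intro powr_mono2) auto
    also have "\<dots> = S * (\<Sum>i\<in>J. w i * d i) powr p"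
      using S assms(1) by (simp add: powr_mult powr_powr)
    also have "\<dots> \<le> S * (\<Sum>i\<in>J. w i * d i powr p)"
      using convex_on_sum[OF J(1) \<open>J \<noteq> {}\<close> convex_on_powr_nonneg[OF assms(1)] w1, of d] S
      by (intro mult_left_mono) (auto simp: w_def d_def)
    also have "\<dots> = (\<Sum>i\<in>J. norm (b i) powr p)"
      unfolding sum_distrib_left using S J
      by (intro sum.cong) (auto simp: w_def d_def powr_divide)
    also have "\<dots> \<le> (\<Sum>i\<in>I. norm (b i) powr p)"
      using J assms(2) by (intro sum_mono2) auto
    finally show ?thesis .
  qed
  show thesis using that[OF _ 2] 1 by (simp add: S_def)
qed

section \<open>Block combinations\<close>

text \<open>
  Combining the terms of disjoint blocks by functionals of norm at most 1 on \<open>l\<^sub>p\<close> does not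
  increase the weak \<open>p\<close>-norm: for each \<open>f\<close> in the dual ball, the \<open>k\<close>-th term is controlled by the
  \<open>k\<close>-th block of \<open>\<Sum> |\<langle>f, x\<^sub>n\<rangle>|\<^sup>p\<close>, and the blocks add up to at most the full sum.
\<close>

lemma weakly_p_summable_blocks:
  fixes s :: "'k::real_normed_field \<Rightarrow> 'a::banach \<Rightarrow> 'a"
  assumes "0 < p" "weakly_p_summable s p x" "strict_mono m"
    and c: "\<And>k (b :: nat \<Rightarrow> 'k).
      norm (\<Sum>n=m k..<m (Suc k). c k n * b n) powr p \<le> (\<Sum>n=m k..<m (Suc k). norm (b n) powr p)"
  shows "weakly_p_summable s p (\<lambda>k. \<Sum>n=m k..<m (Suc k). s (c k n) (x n))"
proof -
  obtain B where
    B: "\<And>f N. f \<in> dual_ball s \<Longrightarrow> (\<Sum>n<N. norm (blinfun_apply f (x n)) powr p) \<le> B"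
    using assms weakly_p_summable_iff_finite_sums by blast
  have "(\<Sum>k<K. norm (blinfun_apply f (\<Sum>n=m k..<m (Suc k). s (c k n) (x n))) powr p) \<le> B"
    if f: "f \<in> dual_ball s" for f K
  proof -
    let ?t = "\<lambda>n. norm (blinfun_apply f (x n)) powr p"
    have "(\<Sum>k<K. norm (blinfun_apply f (\<Sum>n=m k..<m (Suc k). s (c k n) (x n))) powr p)
        \<le> (\<Sum>k<K. \<Sum>n=m k..<m (Suc k). ?t n)"
      by (intro sum_mono) (simp add: dual_apply_sum[OF dual_ball_in_dual[OF f]] c)
    also have "\<dots> = (\<Sum>n=m 0..<m K. ?t n)"
    proof (induction K)
      case (Suc K)
      then show ?case
        using assms(3) by (simp add: sum.atLeastLessThan_concat strict_mono_less_eq)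
    qed simp
    also have "\<dots> \<le> (\<Sum>n<m K. ?t n)" by (rule sum_mono2) auto
    also have "\<dots> \<le> B" by (rule B[OF f])
    finally show ?thesis .
  qed
  then show ?thesis
    unfolding weakly_p_summable_iff_finite_sums[OF assms(1)] by blast
qed

section \<open>The two implications\<close>

text \<open>
  The \<open>n\<close>-th term is one summand of the tail starting at any \<open>M \<le> n\<close>, so uniformly small tails
  force uniformly small terms, first on the dual ball and by rescaling on any bounded set.
\<close>

lemma adj_image_weakly_p_limited:
  assumes "0 < p" "banach_over t" "T \<in> operators s t" "uncond_p_converging s t p T"
    and "K \<subseteq> dual t" "bounded K"
  shows "weakly_p_limited s p (adj T ` K)"
  unfolding weakly_p_limited_def
proof (intro conjI allI impI)
  show "adj T ` K \<subseteq> dual s" using adj_in_dual[OF assms(3)] assms(5) by blast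
  obtain C where C: "0 < C" "\<And>g. g \<in> K \<Longrightarrow> norm g \<le> C"
    using assms(6) by (auto simp: bounded_pos)
  show "bounded (adj T ` K)"
    unfolding bounded_iff
  proof (intro exI ballI)
    fix f assume "f \<in> adj T ` K"
    then obtain g where g: "g \<in> K" "f = adj T g" by blast
    have "norm f \<le> norm g * norm T" by (simp add: g adj_def norm_blinfun_compose)
    also have "\<dots> \<le> C * norm T" by (intro mult_right_mono C g) auto
    finally show "norm f \<le> C * norm T" .
  qed
  fix x assume "weakly_p_summable s p x"
  then have u: "uncond_p_summable t p (\<lambda>n. blinfun_apply T (x n))"
    using assms(4) by (simp add: uncond_p_converging_def)
  show "(\<lambda>n. SUP f\<in>adj T ` K. ennreal (norm (blinfun_apply f (x n)))) \<longlonglongrightarrow> 0"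
  proof (rule order_tendstoI)
    fix a :: ennreal assume "0 < a"
    then obtain b where b: "0 < b" "b < a" using dense by blast
    then obtain e where e: "0 < e" "ennreal e < a" by (cases b) auto
    have "0 < (e / C) powr p" using e C by simp
    then obtain M where M: "\<And>f N. f \<in> dual_ball t \<Longrightarrow>
        (\<Sum>n=M..<N. norm (blinfun_apply f (blinfun_apply T (x n))) powr p) \<le> (e / C) powr p"
      using u unfolding uncond_p_summable_iff_finite_sums[OF assms(1,2)] by meson
    have "norm (blinfun_apply (adj T g) (x n)) \<le> e" if g: "g \<in> K" and n: "M \<le> n" for g n
    proof -
      define f where "f = (1 / C) *\<^sub>R g"
      have f: "f \<in> dual_ball t"
        unfolding f_def using g assms(5) C by (intro normalized_in_dual_ball) auto
      let ?t = "\<lambda>n. norm (blinfun_apply f (blinfun_apply T (x n)))"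
      have "?t n powr p \<le> (\<Sum>n=M..<Suc n. ?t n powr p)"
        by (rule member_le_sum) (use n in auto)
      also have "\<dots> \<le> (e / C) powr p" by (rule M[OF f])
      finally have "?t n \<le> e / C"
        using assms(1) e C
        by (metis divide_pos_pos linorder_not_le powr_less_mono2 less_imp_le)
      then show ?thesis using C by (simp add: f_def adj_def blinfun.scaleR_left divide_simps)
    qed
    then have "(SUP f\<in>adj T ` K. ennreal (norm (blinfun_apply f (x n)))) \<le> ennreal e"
      if "M \<le> n" for n using that by (auto intro!: SUP_least ennreal_leI)
    then show "\<forall>\<^sub>F n in sequentially.
        (SUP f\<in>adj T ` K. ennreal (norm (blinfun_apply f (x n)))) < a"
      using e(2) by (auto simp: eventually_sequentially intro!: exI[of _ M] intro: le_less_trans)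
  qed auto
qed

text \<open>
  A gliding hump argument: if the tails of \<open>\<Sum> |\<langle>g, T x\<^sub>n\<rangle>|\<^sup>p\<close> are not uniformly small over the
  dual ball, then humps of size at least \<open>e\<close> in successive blocks are condensed by norming
  coefficients into single vectors \<open>z k\<close>. These form a weakly \<open>p\<close>-summable sequence on which
  the image of the dual ball under the adjoint is not uniformly small.
\<close>

lemma uncond_p_converging_if_adj_dual_ball_limited:
  fixes s :: "'k::real_normed_field \<Rightarrow> 'a::banach \<Rightarrow> 'a" and t :: "'k \<Rightarrow> 'b::banach \<Rightarrow> 'b"
  assumes p: "1 \<le> p" and "banach_over t" and T: "T \<in> operators s t"
    and lim: "weakly_p_limited s p (adj T ` dual_ball t)"
  shows "uncond_p_converging s t p T"
  unfolding uncond_p_converging_def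
proof (intro allI impI)
  fix x assume x: "weakly_p_summable s p x"
  define a where "a g n = blinfun_apply g (blinfun_apply T (x n))" for g :: "'b \<Rightarrow>\<^sub>L 'k" and n
  have p0: "0 < p" using p by simp
  have "\<exists>M. \<forall>g\<in>dual_ball t. \<forall>N. (\<Sum>n=M..<N. norm (a g n) powr p) \<le> e"
    if e: "0 < e" for e
  proof (rule ccontr)
    assume "\<not> ?thesis"
    then have "\<forall>M. \<exists>g N. g \<in> dual_ball t \<and> e < (\<Sum>n=M..<N. norm (a g n) powr p)"
      by (meson linorder_not_le)
    then obtain G R where G: "\<And>M. G M \<in> dual_ball t"
      and R: "\<And>M. e < (\<Sum>n=M..<R M. norm (a (G M) n) powr p)"
      by metis
    \<comment> \<open>The block is nonempty, since its sum is positive; iterating \<open>R\<close> gives successive blocks.\<close>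
    have "M < R M" for M
      using R[of M] e by (cases "M < R M") auto
    define m where "m k = (R ^^ k) 0" for k
    have m: "m (Suc k) = R (m k)" for k by (simp add: m_def)
    have mono: "strict_mono m"
      unfolding strict_mono_Suc_iff using \<open>\<And>M. M < R M\<close> by (simp add: m)
    let ?S = "\<lambda>k. \<Sum>n=m k..<m (Suc k). norm (a (G (m k)) n) powr p"
    have S: "e < ?S k" for k using R[of "m k"] by (simp add: m)
    have "\<forall>k. \<exists>c. norm (\<Sum>n=m k..<m (Suc k). c n * a (G (m k)) n) = ?S k powr (1 / p) \<and>
        (\<forall>b. norm (\<Sum>n=m k..<m (Suc k). c n * b n) powr p
          \<le> (\<Sum>n=m k..<m (Suc k). norm (b n) powr p))" (is "\<forall>k. \<exists>c. ?P k c")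
    proof
      show "\<exists>c. ?P k c" for k
        by (rule norming_coefficients[OF p, of "{m k..<m (Suc k)}" "a (G (m k))"])
          (use S[of k] e in auto)
    qed
    from choice[OF this] obtain c where P: "\<forall>k. ?P k (c k)" ..
    have c: "norm (\<Sum>n=m k..<m (Suc k). c k n * a (G (m k)) n) = ?S k powr (1 / p)" for k
      using P by blast
    have c_le: "norm (\<Sum>n=m k..<m (Suc k). c k n * b n) powr p
        \<le> (\<Sum>n=m k..<m (Suc k). norm (b n) powr p)" for k b
      using P by blast
    define z where "z k = (\<Sum>n=m k..<m (Suc k). s (c k n) (x n))" for k
    have "weakly_p_summable s p z"
      unfolding z_def by (rule weakly_p_summable_blocks[OF p0 x mono c_le])
    then have "(\<lambda>k. SUP f\<in>adj T ` dual_ball t. ennreal (norm (blinfun_apply f (z k)))) \<longlonglongrightarrow> 0"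
      using lim by (simp add: weakly_p_limited_def)
    then have "\<forall>\<^sub>F k in sequentially.
        (SUP f\<in>adj T ` dual_ball t. ennreal (norm (blinfun_apply f (z k)))) < ennreal (e powr (1 / p))"
      by (rule order_tendstoD) (use e in auto)
    then obtain k where
      k: "(SUP f\<in>adj T ` dual_ball t. ennreal (norm (blinfun_apply f (z k)))) < ennreal (e powr (1 / p))"
      by (auto simp: eventually_sequentially)
    have "blinfun_apply (adj T (G (m k))) (z k) = (\<Sum>n=m k..<m (Suc k). c k n * a (G (m k)) n)"
      unfolding z_def using adj_in_dual[OF T dual_ball_in_dual[OF G]]
      by (simp add: dual_apply_sum) (simp add: a_def adj_def)
    then have "ennreal (?S k powr (1 / p)) \<le>
        (SUP f\<in>adj T ` dual_ball t. ennreal (norm (blinfun_apply f (z k))))"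
      using G[of "m k"] c[of k] by (intro SUP_upper2[of "adj T (G (m k))"]) auto
    with k have "?S k powr (1 / p) < e powr (1 / p)"
      by (metis ennreal_less_iff le_less_trans powr_ge_zero)
    moreover have "e powr (1 / p) \<le> ?S k powr (1 / p)"
      using S[of k] e p0 by (intro powr_mono2) auto
    ultimately show False by simp
  qed
  then show "uncond_p_summable t p (\<lambda>n. blinfun_apply T (x n))"
    using weakly_p_summable_image[OF p0 T x]
    by (simp add: uncond_p_summable_iff_finite_sums[OF p0 assms(2)] a_def)
qed

theorem theorem2p4:
  fixes scaleX :: "'k::real_normed_field \<Rightarrow> 'a::banach \<Rightarrow> 'a"
    and scaleY :: "'k \<Rightarrow> 'b::banach \<Rightarrow> 'b"
    and T :: "'a \<Rightarrow>\<^sub>L 'b"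
    and p :: real
  assumes "1 \<le> p"
    and "banach_over scaleX"
    and "banach_over scaleY"
    and "T \<in> operators scaleX scaleY"
  shows "uncond_p_converging scaleX scaleY p T \<longleftrightarrow>
    (\<forall>K. K \<subseteq> dual scaleY \<and> bounded K \<longrightarrow> weakly_p_limited scaleX p (adj T ` K))"
proof (intro iffI allI impI)
  fix K
  assume "uncond_p_converging scaleX scaleY p T" "K \<subseteq> dual scaleY \<and> bounded K"
  then show "weakly_p_limited scaleX p (adj T ` K)"
    using assms by (intro adj_image_weakly_p_limited) auto
next
  assume "\<forall>K. K \<subseteq> dual scaleY \<and> bounded K \<longrightarrow> weakly_p_limited scaleX p (adj T ` K)"
  moreover have "dual_ball scaleY \<subseteq> dual scaleY" "bounded (dual_ball scaleY)"
    by (auto simp: dual_ball_def bounded_iff)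
  ultimately show "uncond_p_converging scaleX scaleY p T"
    using assms by (intro uncond_p_converging_if_adj_dual_ball_limited) auto
qed

end
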